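(* Let $c$ denote the circumradius function of the evader's path $E(t)$ in a discrete-time simple pursuit game on a CAT(0) space $X$. Then $c\in\Omega(t^{1/2})$ is a necessary condition for the evader to win; that is, if the evader wins, then $c\in\Omega(t^{1/2})$ as $t\to\infty$.
   Context: A CAT(0) space is a geodesic metric space $(X,d)$ in which the distance between any two points of any geodesic triangle is at most the distance between the corresponding points of the triangle with the same sidelengths in the Euclidean plane. Discrete-time simple pursuit with step size $D>0$: a pursuer $P$ and an evader $E$ start at $P_0,E_0\in X$. At the $i$-th step ($i\ge1$) the evader moves from $E_{i-1}$ to a point $E_i$ of its choice with $d(E_{i-1},E_i)\le D$, and the pursuer moves to $P_i$, the point at distance $D$ from $P_{i-1}$ on the geodesic from $P_{i-1}$ to $E_{i-1}$. Play ends with a win for the pursuer if $d(P_i,E_i)\le D$ for some $i$. The sequence $L_i=d(P_i,E_i)$ is non-increasing. The evader wins if and only if play continues forever and $\lim_{i\to\infty}L_i>D$. The evader's path $E(t)$ is obtained by joining the successive $E_i$ by geodesic segments, with $E(iD)=E_i$ and constant speed ($\le1$) on each interval $[iD,(i+1)D]$. Its circumradius function is $c(t)$ = the smallest number such that $E|_{[0,t]}$ lies in the (closed) ball of radius $c(t)$ about $E(0)$. $c\in\Omega(t^{1/2})$ means $c(t)\ge Ct^{1/2}$ for some constant $C>0$ and all sufficiently large $t$. *)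

theory Defs
  imports "HOL-Analysis.Analysis" "HOL-Library.Landau_Symbols"
begin

text \<open>
  The space \<open>X\<close> is given by a carrier set and a distance function as in the locale
  \<^locale>\<open>Metric_space\<close>.
\<close>

definition geodesic ::
  "'a set \<Rightarrow> ('a \<Rightarrow> 'a \<Rightarrow> real) \<Rightarrow> 'a \<Rightarrow> 'a \<Rightarrow> (real \<Rightarrow> 'a) \<Rightarrow> bool" where
  "geodesic X d x y g \<longleftrightarrow>
     g ` {0..d x y} \<subseteq> X \<and> g 0 = x \<and> g (d x y) = y \<and>
     (\<forall>s\<in>{0..d x y}. \<forall>t\<in>{0..d x y}. d (g s) (g t) = \<bar>s - t\<bar>)"

text \<open>
  Pairs \<open>(p, p')\<close> of a point \<open>p\<close> of the side \<open>g\<close> from \<open>x\<close> to \<open>y\<close> and the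
  corresponding point \<open>p'\<close> of the Euclidean segment from \<open>x'\<close> to \<open>y'\<close>, which is meant
  to have the same length as \<open>g\<close>.
\<close>

definition corresponding ::
  "('a \<Rightarrow> 'a \<Rightarrow> real) \<Rightarrow> 'a \<Rightarrow> 'a \<Rightarrow> (real \<Rightarrow> 'a) \<Rightarrow> real^2 \<Rightarrow> real^2 \<Rightarrow> ('a \<times> (real^2)) set"
  where
  "corresponding d x y g x' y' =
     {(p, p'). p \<in> g ` {0..d x y} \<and> p' \<in> closed_segment x' y' \<and> dist x' p' = d x p}"

definition CAT0_space :: "'a set \<Rightarrow> ('a \<Rightarrow> 'a \<Rightarrow> real) \<Rightarrow> bool" where
  "CAT0_space X d \<longleftrightarrow>
     Metric_space X d \<and>
     (\<forall>x\<in>X. \<forall>y\<in>X. \<exists>g. geodesic X d x y g) \<and>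
     (\<forall>x\<in>X. \<forall>y\<in>X. \<forall>z\<in>X. \<forall>f g h. \<forall>x' y' z'.
        geodesic X d x y f \<and> geodesic X d y z g \<and> geodesic X d z x h \<and>
        dist x' y' = d x y \<and> dist y' z' = d y z \<and> dist z' x' = d z x \<longrightarrow>
        (let C = corresponding d x y f x' y' \<union> corresponding d y z g y' z' \<union>
                 corresponding d z x h z' x'
         in \<forall>(p, p')\<in>C. \<forall>(q, q')\<in>C. d p q \<le> dist p' q'))"

text \<open>
  A play is a pair of sequences \<open>E\<close>, \<open>P\<close>; the moves are constrained only as long as
  the play has not ended, so entries after the pursuer's win are irrelevant.  Geodesics in CAT(0)
  spaces are unique, so an arbitrary \<open>g\<close> is the geodesic from \<open>P i\<close> to \<open>E i\<close>.
\<close>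

definition simple_pursuit ::
  "'a set \<Rightarrow> ('a \<Rightarrow> 'a \<Rightarrow> real) \<Rightarrow> real \<Rightarrow> (nat \<Rightarrow> 'a) \<Rightarrow> (nat \<Rightarrow> 'a) \<Rightarrow> bool" where
  "simple_pursuit X d D E P \<longleftrightarrow>
     E 0 \<in> X \<and> P 0 \<in> X \<and>
     (\<forall>i. (\<forall>j\<le>i. d (P j) (E j) > D) \<longrightarrow>
        E (Suc i) \<in> X \<and> d (E i) (E (Suc i)) \<le> D \<and>
        (\<exists>g. geodesic X d (P i) (E i) g \<and> P (Suc i) = g D))"

definition evader_wins ::
  "('a \<Rightarrow> 'a \<Rightarrow> real) \<Rightarrow> real \<Rightarrow> (nat \<Rightarrow> 'a) \<Rightarrow> (nat \<Rightarrow> 'a) \<Rightarrow> bool" where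
  "evader_wins d D E P \<longleftrightarrow>
     (\<forall>i. d (P i) (E i) > D) \<and> (\<exists>l>D. (\<lambda>i. d (P i) (E i)) \<longlonglongrightarrow> l)"

text \<open>Values of the path at negative times are left arbitrary.\<close>

definition evader_path ::
  "'a set \<Rightarrow> ('a \<Rightarrow> 'a \<Rightarrow> real) \<Rightarrow> real \<Rightarrow> (nat \<Rightarrow> 'a) \<Rightarrow> (real \<Rightarrow> 'a) \<Rightarrow> bool" where
  "evader_path X d D E e \<longleftrightarrow>
     (\<forall>i. \<exists>g. geodesic X d (E i) (E (Suc i)) g \<and>
        (\<forall>t\<in>{real i * D..real (Suc i) * D}.
           e t = g (d (E i) (E (Suc i)) / D * (t - real i * D))))"

definition circumradius ::
  "'a set \<Rightarrow> ('a \<Rightarrow> 'a \<Rightarrow> real) \<Rightarrow> (real \<Rightarrow> 'a) \<Rightarrow> real \<Rightarrow> real" where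
  "circumradius X d e t = (LEAST r. e ` {0..t} \<subseteq> Metric_space.mcball X d (e 0) r)"

end

theory Submission
  imports Defs "HOL-Real_Asymp.Real_Asymp"
begin

text \<open>
  The pursuer's path turns too little to stay in a small ball.  When the pursuer has reached
  \<open>P (i + 1)\<close>, its distance \<open>L\<close> to \<open>E i\<close> has shrunk by the full step \<open>D\<close>; the evader's move
  restores \<open>D\<close> up to a loss \<open>\<delta> = L i - L (i + 1)\<close>.  So the evader runs almost straight away
  from the pursuer, and the pursuer's direction turns by an angle of order \<open>sqrt \<delta>\<close> only, because
  \<open>L\<close> stays bounded away from \<open>D\<close>.  The losses have a finite sum, so by the
  Cauchy-Schwarz inequality the first \<open>n\<close> rounds turn the pursuer by an angle of order \<open>sqrt n\<close> in
  total.  In Euclidean space write \<open>T i\<close> for the unit vector from \<open>P i\<close> to \<open>E i\<close> and \<open>c = E 0\<close>: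
  the inner product of \<open>T i\<close> with \<open>P i - c\<close> grows in each round by \<open>D\<close>, up to an error of the
  radius \<open>r\<close> times the turning angle.  As this inner product never exceeds \<open>r\<close> by more than a
  constant, \<open>n\<close> rounds within radius \<open>r\<close> give \<open>D n \<le> C (r + 1) sqrt n + C'\<close> for constants \<open>C\<close>, \<open>C'\<close>,
  whence \<open>r\<close> is at least of order \<open>sqrt n\<close>.

  In a CAT(0) space the inner product is replaced by the expression \<open>radial\<close>, which is read off
  from the three distances between \<open>c\<close>, \<open>P i\<close>, \<open>E i\<close>.  Its behaviour in one round
  (\<open>radial_advance\<close> for the pursuer's move and \<open>radial_turn\<close> for the evader's) uses the CAT(0)
  condition only through \<open>Stewart_inequality\<close>, which bounds the distance from a vertex to a point
  of the opposite side.  Summing over the rounds is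
  \<open>radial_pursuit\<close>.
\<close>

section \<open>Distances in CAT(0) spaces\<close>

text \<open>The comparison triangle of three points, with one side laid along the first axis.\<close>

lemma Euclidean_triangle_exists:
  fixes a b c :: real
  assumes "0 < b" "0 \<le> a" "0 \<le> c" "a \<le> b + c" "b \<le> a + c" "c \<le> a + b"
  obtains x y z :: "real^2" where "dist x y = a" "dist y z = b" "dist z x = c"
proof -
  \<comment> \<open>\<open>u\<close> is forced by subtracting the equations for the sides \<open>a\<close> and \<open>c\<close>; the triangle
    inequalities say exactly that \<open>a\<^sup>2 - u\<^sup>2\<close> is nonnegative.\<close>
  define u where "u = (a\<^sup>2 + b\<^sup>2 - c\<^sup>2) / (2 * b)"
  define v where "v = sqrt (a\<^sup>2 - u\<^sup>2)"
  have "(a - b)\<^sup>2 \<le> c\<^sup>2" "c\<^sup>2 \<le> (a + b)\<^sup>2"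
    using assms by (auto intro!: power_mono simp: abs_le_square_iff[symmetric])
  then have "\<bar>a\<^sup>2 + b\<^sup>2 - c\<^sup>2\<bar> \<le> 2 * a * b"
    by (simp add: power2_eq_square algebra_simps abs_le_iff)
  then have "\<bar>u\<bar> \<le> \<bar>a\<bar>"
    using assms by (simp add: u_def field_simps)
  then have "u\<^sup>2 \<le> a\<^sup>2"
    by (simp only: abs_le_square_iff)
  then have uv: "u\<^sup>2 + v\<^sup>2 = a\<^sup>2"
    by (simp add: v_def)
  have "2 * b * u = a\<^sup>2 + b\<^sup>2 - c\<^sup>2"
    using assms by (simp add: u_def)
  then have uvb: "(b - u)\<^sup>2 + v\<^sup>2 = c\<^sup>2"
    using uv by (simp add: power2_eq_square algebra_simps)
  show ?thesis
  proof
    show "dist (vector [u, v]) (0 :: real^2) = a"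
      using assms uv by (simp add: norm_vec_def L2_set_def sum_2)
    show "dist 0 (vector [b, 0] :: real^2) = b"
      using assms by (simp add: norm_vec_def L2_set_def sum_2)
    show "dist (vector [b, 0] :: real^2) (vector [u, v]) = c"
      using assms uvb by (simp add: dist_vec_def dist_real_def L2_set_def sum_2)
  qed
qed

lemma Euclidean_Stewart:
  fixes x y z :: "'a::real_inner"
  shows "(dist x (y + t *\<^sub>R (z - y)))\<^sup>2
    = (1 - t) * (dist x y)\<^sup>2 + t * (dist x z)\<^sup>2 - t * (1 - t) * (dist y z)\<^sup>2"
  unfolding dist_norm power2_norm_eq_inner
  by (simp add: inner_simps inner_commute algebra_simps)

locale CAT0 =
  fixes X :: "'a set" and d :: "'a \<Rightarrow> 'a \<Rightarrow> real"
  assumes CAT0: "CAT0_space X d"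
begin

sublocale Metric_space X d
  using CAT0 by (simp add: CAT0_space_def)

lemma geodesic_exists:
  assumes "x \<in> X" "y \<in> X"
  obtains g where "geodesic X d x y g"
  using CAT0 assms unfolding CAT0_space_def by blast

lemma geodesic_point:
  assumes "geodesic X d x y g" "0 \<le> s" "s \<le> d x y"
  shows "g s \<in> X" "d x (g s) = s" "d (g s) y = d x y - s"
proof -
  have dg: "d (g s) (g t) = \<bar>s - t\<bar>" if "0 \<le> s" "s \<le> d x y" "0 \<le> t" "t \<le> d x y" for s t
    using assms(1) that by (auto simp: geodesic_def)
  have g: "g 0 = x" "g (d x y) = y"
    using assms(1) by (auto simp: geodesic_def)
  show "g s \<in> X" using assms by (auto simp: geodesic_def)
  show "d x (g s) = s" using dg[of 0 s] assms g by auto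
  show "d (g s) y = d x y - s" using dg[of s "d x y"] assms g by auto
qed

text \<open>
  In the Euclidean plane, Stewart's theorem expresses the length of the segment from a vertex to a
  point of the opposite side by the sides of the triangle; comparison turns this identity into an
  inequality.
\<close>

lemma Stewart_inequality:
  assumes x: "x \<in> X" and y: "y \<in> X" and z: "z \<in> X"
    and g: "geodesic X d y z g" and s: "0 \<le> s" "s \<le> d y z" and pos: "0 < d y z"
  shows "(d x (g s))\<^sup>2
    \<le> (1 - s / d y z) * (d x y)\<^sup>2 + s / d y z * (d x z)\<^sup>2 - s * (d y z - s)"
proof -
  obtain f where f: "geodesic X d x y f" using x y by (rule geodesic_exists)
  obtain h where h: "geodesic X d z x h" using z x by (rule geodesic_exists)
  have tri: "d x y \<le> d y z + d z x" "d y z \<le> d x y + d z x" "d z x \<le> d x y + d y z"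
    using triangle[OF x z y] triangle[OF y x z] triangle[OF z y x]
    by (simp_all add: commute add.commute)
  obtain x' y' z' :: "real^2"
    where e: "dist x' y' = d x y" "dist y' z' = d y z" "dist z' x' = d z x"
    using Euclidean_triangle_exists[OF pos nonneg nonneg tri] by blast
  define t where "t = s / d y z"
  define p' where "p' = y' + t *\<^sub>R (z' - y')"
  have t: "0 \<le> t" "t \<le> 1" using s pos by (simp_all add: t_def)
  have "dist y' p' = t * d y z"
    using t e(2) by (simp add: p'_def dist_norm norm_minus_commute)
  then have p': "dist y' p' = s" using pos by (simp add: t_def)
  have "p' \<in> closed_segment y' z'"
    unfolding closed_segment_def p'_def using t by (auto simp: algebra_simps intro!: exI[of _ t])
  then have p: "(g s, p') \<in> corresponding d y z g y' z'"
    using p' s geodesic_point(2)[OF g s] by (auto simp: corresponding_def)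
  have "x \<in> f ` {0..d x y}"
    using f by (auto simp: geodesic_def intro!: image_eqI[of x f 0])
  then have q: "(x, x') \<in> corresponding d x y f x' y'"
    using x by (auto simp: corresponding_def)
  have "\<forall>(p, p')\<in>corresponding d x y f x' y' \<union> corresponding d y z g y' z' \<union>
                 corresponding d z x h z' x'.
        \<forall>(q, q')\<in>corresponding d x y f x' y' \<union> corresponding d y z g y' z' \<union>
                 corresponding d z x h z' x'. d p q \<le> dist p' q'"
    using CAT0 x y z f g h e unfolding CAT0_space_def Let_def by blast
  then have "d x (g s) \<le> dist x' p'"
    using p q by fast
  then have "(d x (g s))\<^sup>2 \<le> (dist x' p')\<^sup>2"
    by (simp add: power_mono)
  also have "\<dots> = (1 - t) * (d x y)\<^sup>2 + t * (d x z)\<^sup>2 - t * (1 - t) * (d y z)\<^sup>2"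
    unfolding p'_def Euclidean_Stewart using e by (simp add: dist_commute commute)
  also have "t * (1 - t) * (d y z)\<^sup>2 = s * (d y z - s)"
    using pos by (simp add: t_def field_simps power2_eq_square)
  finally show ?thesis by (simp add: t_def)
qed

section \<open>The radial component of a direction\<close>

text \<open>
  In Euclidean space this is the inner product of \<open>p - c\<close> with the unit vector from \<open>p\<close> to \<open>q\<close>.
  In general it is \<open>- d c p\<close> times the cosine of the comparison angle at \<open>p\<close>.
\<close>

definition radial :: "'a \<Rightarrow> 'a \<Rightarrow> 'a \<Rightarrow> real" where
  "radial c p q = ((d c q)\<^sup>2 - (d c p)\<^sup>2 - (d p q)\<^sup>2) / (2 * d p q)"

lemma radial_eq:
  assumes "d p q \<noteq> 0"
  shows "radial c p q = (((d c q)\<^sup>2 - (d c p)\<^sup>2) / d p q - d p q) / 2"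
  using assms by (simp add: radial_def field_simps power2_eq_square)

lemma radial_le_dist:
  assumes "c \<in> X" "p \<in> X" "q \<in> X"
  shows "radial c p q \<le> d c p"
proof (cases "d p q = 0")
  case False
  then have "0 < d p q" by (simp add: order_less_le)
  moreover have "(d c q)\<^sup>2 \<le> (d c p + d p q)\<^sup>2"
    using triangle assms by (simp add: power_mono)
  ultimately show ?thesis
    by (simp add: radial_def field_simps power2_eq_square)
qed (simp add: radial_def)

text \<open>
  In Euclidean space, moving \<open>p\<close> towards \<open>q\<close> by \<open>s\<close> adds exactly \<open>s\<close>.  Nonpositive curvature
  makes distances to \<open>c\<close> more convex, so it can only add more.
\<close>

lemma radial_advance:
  assumes "c \<in> X" "p \<in> X" "q \<in> X" and g: "geodesic X d p q g" and s: "0 \<le> s" "s < d p q"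
  shows "radial c p q + s \<le> radial c (g s) q"
proof -
  define L where "L = d p q"
  have L: "0 < L" "0 < L - s" using s by (simp_all add: L_def)
  have "(d c (g s))\<^sup>2 \<le> (1 - s / L) * (d c p)\<^sup>2 + s / L * (d c q)\<^sup>2 - s * (L - s)"
    using Stewart_inequality[OF assms(1-3) g] s by (simp add: L_def)
  then have "(L - s) * (((d c q)\<^sup>2 - (d c p)\<^sup>2) / L + s) \<le> (d c q)\<^sup>2 - (d c (g s))\<^sup>2"
    using L by (simp add: field_simps)
  then have "((d c q)\<^sup>2 - (d c p)\<^sup>2) / L + s \<le> ((d c q)\<^sup>2 - (d c (g s))\<^sup>2) / (L - s)"
    using L by (simp add: pos_le_divide_eq mult.commute)
  moreover have "radial c p q = (((d c q)\<^sup>2 - (d c p)\<^sup>2) / L - L) / 2"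
    using L by (simp add: radial_eq flip: L_def)
  moreover have "radial c (g s) q = (((d c q)\<^sup>2 - (d c (g s))\<^sup>2) / (L - s) - (L - s)) / 2"
    using L geodesic_point(3)[OF g, of s] s
    by (simp add: radial_eq flip: L_def)
  ultimately show ?thesis by simp
qed

text \<open>This is the monotonicity of comparison angles: the angle at \<open>p\<close> grows with the side.\<close>

lemma radial_mono:
  assumes "c \<in> X" "p \<in> X" "q \<in> X" and g: "geodesic X d p q g" and s: "0 < s" "s \<le> d p q"
  shows "radial c p (g s) \<le> radial c p q"
proof -
  define L where "L = d p q"
  have L: "0 < L" using s by (simp add: L_def)
  have "(d c (g s))\<^sup>2 \<le> (1 - s / L) * (d c p)\<^sup>2 + s / L * (d c q)\<^sup>2 - s * (L - s)"
    using Stewart_inequality[OF assms(1-3) g] s by (simp add: L_def)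
  then have "(d c (g s))\<^sup>2 - (d c p)\<^sup>2 \<le> s * (((d c q)\<^sup>2 - (d c p)\<^sup>2) / L - (L - s))"
    using L by (simp add: field_simps)
  then have "((d c (g s))\<^sup>2 - (d c p)\<^sup>2) / s \<le> ((d c q)\<^sup>2 - (d c p)\<^sup>2) / L - (L - s)"
    using s by (simp add: pos_divide_le_eq mult.commute)
  moreover have "radial c p q = (((d c q)\<^sup>2 - (d c p)\<^sup>2) / L - L) / 2"
    using L by (simp add: radial_eq flip: L_def)
  moreover have "radial c p (g s) = (((d c (g s))\<^sup>2 - (d c p)\<^sup>2) / s - s) / 2"
    using geodesic_point(2)[OF g, of s] s
    by (simp add: radial_eq)
  ultimately show ?thesis by simp
qed

text \<open>
  The point \<open>g (d p q)\<close> is as far from \<open>p\<close> as \<open>q\<close> is, in the direction of \<open>q'\<close>.  If moving from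
  \<open>q\<close> to \<open>q'\<close> increases the distance from \<open>p\<close> by nearly the length \<open>D\<close> of the move, then little
  is left for a change of direction, as in a right triangle with hypotenuse \<open>D\<close>.
\<close>

lemma dist_isosceles_le:
  assumes "p \<in> X" "q \<in> X" "q' \<in> X" and g: "geodesic X d p q' g"
    and pos: "0 < d p q" and le: "d p q \<le> d p q'"
    and D: "d q q' \<le> D"
  shows "(d q (g (d p q)))\<^sup>2 \<le> D\<^sup>2 - (d p q' - d p q)\<^sup>2"
proof -
  define \<rho> L where "\<rho> = d p q" and "L = d p q'"
  have L: "0 < \<rho>" "\<rho> \<le> L" "0 < L" using pos le by (simp_all add: \<rho>_def L_def)
  have "d q q' \<ge> d p q' - d p q"
    using triangle[of p q q'] assms by simp
  then have "(L - \<rho>)\<^sup>2 \<le> (d q q')\<^sup>2"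
    using le by (simp add: \<rho>_def L_def power_mono)
  moreover have "(d q q')\<^sup>2 \<le> D\<^sup>2"
    using D by (simp add: power_mono)
  ultimately have D': "(L - \<rho>)\<^sup>2 \<le> D\<^sup>2" "(d q q')\<^sup>2 \<le> D\<^sup>2" by auto
  have "(d q (g \<rho>))\<^sup>2 \<le> (1 - \<rho> / L) * \<rho>\<^sup>2 + \<rho> / L * (d q q')\<^sup>2 - \<rho> * (L - \<rho>)"
    using Stewart_inequality[OF assms(2,1,3) g, of \<rho>] L
    by (simp add: \<rho>_def L_def commute)
  also have "\<dots> \<le> (1 - \<rho> / L) * \<rho>\<^sup>2 + \<rho> / L * D\<^sup>2 - \<rho> * (L - \<rho>)"
    using D' L by (simp add: mult_left_mono divide_right_mono)
  also have "\<dots> = \<rho> / L * (D\<^sup>2 - (L - \<rho>)\<^sup>2)"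
    using L by (simp add: field_simps power2_eq_square)
  also have "\<dots> \<le> 1 * (D\<^sup>2 - (L - \<rho>)\<^sup>2)"
    using D' L by (intro mult_right_mono) auto
  finally show ?thesis by (simp add: \<rho>_def L_def)
qed

text \<open>
  To compare the directions of \<open>q\<close> and \<open>q'\<close> at \<open>p\<close>, cut the segment to \<open>q'\<close> at the distance of
  \<open>q\<close>.  Between endpoints at the same distance from \<open>p\<close>, \<open>radial\<close> varies only through their distances from
  \<open>c\<close>, whose difference is controlled by \<open>dist_isosceles_le\<close>; cutting can only lower the value, by \<open>radial_mono\<close>.
  This is why \<open>q'\<close> must be the farther of the two.
\<close>

lemma radial_turn:
  assumes "c \<in> X" "p \<in> X" "q \<in> X" "q' \<in> X"
    and pos: "0 < \<rho>" "\<rho> \<le> d p q" and le: "d p q \<le> d p q'"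
    and D: "d q q' \<le> D" and r: "d c q \<le> r"
  shows "radial c p q - (r + D) / \<rho> * sqrt (D\<^sup>2 - (d p q' - d p q)\<^sup>2) \<le> radial c p q'"
proof -
  obtain g where g: "geodesic X d p q' g" using assms geodesic_exists by blast
  define w where "w = g (d p q)"
  define \<epsilon> where "\<epsilon> = sqrt (D\<^sup>2 - (d p q' - d p q)\<^sup>2)"
  have w: "w \<in> X" "d p w = d p q"
    unfolding w_def using geodesic_point[OF g] le by auto
  have "(d q w)\<^sup>2 \<le> D\<^sup>2 - (d p q' - d p q)\<^sup>2"
    unfolding w_def using dist_isosceles_le[OF assms(2-4) g _ le D] pos by simp
  then have qw: "d q w \<le> \<epsilon>"
    unfolding \<epsilon>_def by (rule real_le_rsqrt)
  have D0: "0 \<le> D" using D nonneg[of q q'] by linarith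
  have "\<epsilon> \<le> sqrt (D\<^sup>2)" unfolding \<epsilon>_def by (rule real_sqrt_le_mono) simp
  then have \<epsilon>: "\<epsilon> \<le> D" using D0 by simp
  have \<epsilon>0: "0 \<le> \<epsilon>" using qw nonneg[of q w] by linarith
  have "d c q \<le> d c w + d q w"
    using triangle[of c w q] assms w by (simp add: commute)
  moreover have "d c w \<le> d c q + d q w"
    using triangle[of c q w] assms w by simp
  ultimately have "d c q - d c w \<le> \<epsilon>" "d c w \<le> r + D"
    using qw r \<epsilon> by linarith+
  then have "(d c q - d c w) * (d c q + d c w) \<le> \<epsilon> * (d c q + d c w)"
    by (intro mult_right_mono) simp_all
  also have "\<dots> \<le> \<epsilon> * (2 * (r + D))"
    using r D0 \<epsilon>0 \<open>d c w \<le> r + D\<close> by (intro mult_left_mono) auto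
  finally have diff: "((d c q)\<^sup>2 - (d c w)\<^sup>2) / d p q \<le> \<epsilon> * (2 * (r + D)) / d p q"
    using pos by (simp add: power2_eq_square algebra_simps divide_right_mono)
  have half: "2 * x / y / 2 = x / y" for x y :: real
    by simp
  have "radial c p q - radial c p w = ((d c q)\<^sup>2 - (d c w)\<^sup>2) / d p q / 2"
    using w pos by (simp add: radial_eq diff_divide_distrib)
  also have "\<dots> \<le> \<epsilon> * (2 * (r + D)) / d p q / 2"
    using diff by (rule divide_right_mono) simp
  also have "\<dots> = \<epsilon> * (r + D) / d p q"
    using half[of "\<epsilon> * (r + D)" "d p q"] by (simp only: mult.left_commute[of \<epsilon> 2])
  also have "\<dots> \<le> \<epsilon> * (r + D) / \<rho>"
    using pos \<epsilon>0 D0 order_trans[OF nonneg r]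
    by (intro divide_left_mono mult_nonneg_nonneg add_nonneg_nonneg) auto
  finally have "radial c p q - (r + D) / \<rho> * \<epsilon> \<le> radial c p w"
    by (simp add: mult.commute)
  also have "\<dots> \<le> radial c p q'"
    unfolding w_def using radial_mono[OF assms(1,2,4) g, of "d p q"] pos le by simp
  finally show ?thesis by (simp add: \<epsilon>_def)
qed

text \<open>
  One round, with the pursuer moving from \<open>p\<close> to \<open>g D\<close> and the evader from \<open>q\<close> to \<open>q'\<close>.  The
  hypothesis \<open>d p q - D \<le> d (g D) q'\<close> says that the evader's move does not bring it closer to the
  pursuer's new position, as \<open>radial_turn\<close> requires.
\<close>

lemma radial_pursuit_step:
  assumes "c \<in> X" "p \<in> X" "q \<in> X" "q' \<in> X"
    and g: "geodesic X d p q g" and "0 \<le> D" "D < l" "l \<le> d p q"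
    and D: "d q q' \<le> D" and le: "d p q - D \<le> d (g D) q'" and r: "d c q \<le> r"
  shows "radial c p q + D - (r + D) / (l - D) * sqrt (2 * D * (d p q - d (g D) q'))
    \<le> radial c (g D) q'"
proof -
  have gD: "g D \<in> X" "d (g D) q = d p q - D"
    using geodesic_point[OF g, of D] assms by auto
  \<comment> \<open>The part of the evader's step that leads away from the pursuer.\<close>
  define u where "u = d (g D) q' - d (g D) q"
  have u: "d p q - d (g D) q' = D - u"
    using gD by (simp add: u_def)
  have "2 * D * (d p q - d (g D) q') = D\<^sup>2 - u\<^sup>2 + (D - u)\<^sup>2"
    unfolding u by (simp add: power2_eq_square algebra_simps)
  then have "sqrt (D\<^sup>2 - u\<^sup>2) \<le> sqrt (2 * D * (d p q - d (g D) q'))"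
    by simp
  then have "(r + D) / (l - D) * sqrt (D\<^sup>2 - u\<^sup>2)
      \<le> (r + D) / (l - D) * sqrt (2 * D * (d p q - d (g D) q'))"
    using assms order_trans[OF nonneg r]
    by (intro mult_left_mono divide_nonneg_nonneg add_nonneg_nonneg) auto
  moreover have "radial c p q + D \<le> radial c (g D) q"
    using radial_advance[OF assms(1-3) g] assms by simp
  moreover have "radial c (g D) q - (r + D) / (l - D) * sqrt (D\<^sup>2 - u\<^sup>2) \<le> radial c (g D) q'"
    unfolding u_def using gD assms
    by (intro radial_turn) auto
  ultimately show ?thesis by simp
qed

section \<open>The pursuit\<close>

lemma evader_wins_positions:
  assumes "simple_pursuit X d D E P" "evader_wins d D E P" "D > 0"
  shows "E i \<in> X" "P i \<in> X" "d (E i) (E (Suc i)) \<le> D"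
    "\<exists>g. geodesic X d (P i) (E i) g \<and> P (Suc i) = g D"
proof -
  have far: "d (P i) (E i) > D" for i
    using assms by (simp add: evader_wins_def)
  have step: "E (Suc i) \<in> X \<and> d (E i) (E (Suc i)) \<le> D \<and>
      (\<exists>g. geodesic X d (P i) (E i) g \<and> P (Suc i) = g D)" for i
    using assms far by (simp add: simple_pursuit_def)
  show "E i \<in> X"
    using step assms by (cases i) (auto simp: simple_pursuit_def)
  show "P i \<in> X"
  proof (cases i)
    case 0
    then show ?thesis using assms by (simp add: simple_pursuit_def)
  next
    case (Suc j)
    then obtain g where "geodesic X d (P j) (E j) g" "P i = g D"
      using step by blast
    then show ?thesis
      using geodesic_point(1) far[of j] assms(3) by simp
  qed
  show "d (E i) (E (Suc i)) \<le> D" "\<exists>g. geodesic X d (P i) (E i) g \<and> P (Suc i) = g D"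
    using step by auto
qed

lemma pursuit_distance_antimono:
  assumes "simple_pursuit X d D E P" "evader_wins d D E P" "D > 0"
  shows "decseq (\<lambda>i. d (P i) (E i))"
proof (rule decseq_SucI)
  fix i
  note pos = evader_wins_positions[OF assms]
  obtain g where g: "geodesic X d (P i) (E i) g" "P (Suc i) = g D" using pos(4) by blast
  have "d (P i) (E i) > D"
    using assms by (simp add: evader_wins_def)
  then have "d (P (Suc i)) (E i) = d (P i) (E i) - D"
    using geodesic_point(3)[OF g(1), of D] g assms(3) by simp
  then show "d (P (Suc i)) (E (Suc i)) \<le> d (P i) (E i)"
    using triangle[of "P (Suc i)" "E i" "E (Suc i)"] pos(1,2) pos(3)[of i] by force
qed

text \<open>
  The growth of \<open>radial\<close> over the \<open>m\<close> rounds from round \<open>N\<close> on.  By round \<open>N\<close> the distance is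
  within \<open>D\<close> of its lower bound \<open>l\<close>, so no later round loses more than \<open>D\<close>, as
  \<open>radial_pursuit_step\<close> requires, and all later losses together are at most \<open>D\<close>.
\<close>

lemma radial_pursuit:
  assumes game: "simple_pursuit X d D E P" "evader_wins d D E P" "D > 0"
    and l: "D < l" "\<And>i. l \<le> d (P i) (E i)" and N: "d (P N) (E N) \<le> l + D"
    and c: "c \<in> X" and r: "\<And>i. i < N + m \<Longrightarrow> d c (E i) \<le> r" "0 \<le> r"
  shows "radial c (P N) (E N) + D * real m - (r + D) * (sqrt 2 * D / (l - D)) * sqrt (real m)
    \<le> radial c (P (N + m)) (E (N + m))"
proof -
  note pos = evader_wins_positions[OF game]
  define L where "L i = d (P i) (E i)" for i
  \<comment> \<open>Up to a constant factor, a bound for the angle by which the pursuer turns in round \<open>N + i\<close>.\<close>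
  define s where "s i = sqrt (2 * D * (L (N + i) - L (N + Suc i)))" for i
  have L: "decseq L" "l \<le> L i" "L N \<le> l + D" for i
    unfolding L_def using pursuit_distance_antimono[OF game] l N by simp_all
  have "radial c (P N) (E N) + D * real k - (r + D) / (l - D) * (\<Sum>i<k. s i)
      \<le> radial c (P (N + k)) (E (N + k))" if "k \<le> m" for k
    using that
  proof (induction k)
    case (Suc k)
    obtain g where g: "geodesic X d (P (N + k)) (E (N + k)) g" "P (Suc (N + k)) = g D"
      using pos(4) by blast
    have "L (N + k) \<le> L N" using decseqD[OF L(1), of N "N + k"] by simp
    then have "L (N + k) - D \<le> L (N + Suc k)" using L(2)[of "N + Suc k"] L(3) by linarith
    then have "radial c (P (N + k)) (E (N + k)) + D - (r + D) / (l - D) * s k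
        \<le> radial c (P (N + Suc k)) (E (N + Suc k))"
      using radial_pursuit_step[OF c pos(2) pos(1) pos(1) g(1) _ l(1) l(2) pos(3)] game(3)
        r(1)[of "N + k"] Suc.prems g(2)
      by (simp add: s_def L_def)
    then show ?case
      using Suc by (simp add: algebra_simps add_divide_distrib)
  qed simp
  then have sum: "radial c (P N) (E N) + D * real m - (r + D) / (l - D) * (\<Sum>i<m. s i)
      \<le> radial c (P (N + m)) (E (N + m))"
    by simp
  have sq: "(sqrt 2)\<^sup>2 = (2::real)" "(sqrt (real m))\<^sup>2 = real m"
    by simp_all
  have "(\<Sum>i<m. 1 * s i)\<^sup>2 \<le> (\<Sum>i<m. 1\<^sup>2) * (\<Sum>i<m. (s i)\<^sup>2)"
    by (rule Cauchy_Schwarz_ineq_sum)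
  also have "(\<Sum>i<m. (s i)\<^sup>2) = (\<Sum>i<m. 2 * D * (L (N + i) - L (N + Suc i)))"
    using L(1) game(3) by (intro sum.cong) (auto simp: s_def decseq_Suc_iff)
  also have "\<dots> = 2 * D * (L N - L (N + m))"
    using sum_lessThan_telescope'[of "\<lambda>i. L (N + i)" m] by (simp flip: sum_distrib_left)
  also have "(\<Sum>i<m. 1\<^sup>2) * (2 * D * (L N - L (N + m))) \<le> real m * (2 * D * D)"
    using game(3) L(2)[of "N + m"] L(3) by (simp add: mult_left_mono)
  also have "\<dots> = (sqrt 2 * D * sqrt (real m))\<^sup>2"
    using sq by (simp only: power_mult_distrib power2_eq_square[of D] ac_simps)
  finally have "(\<Sum>i<m. 1 * s i) \<le> sqrt 2 * D * sqrt (real m)"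
    by (rule power2_le_imp_le) (use game(3) in simp)
  then have "(\<Sum>i<m. s i) \<le> sqrt 2 * D * sqrt (real m)"
    by simp
  then have "(r + D) / (l - D) * (\<Sum>i<m. s i) \<le> (r + D) / (l - D) * (sqrt 2 * D * sqrt (real m))"
    using r(2) game(3) l(1) by (intro mult_left_mono) auto
  then show ?thesis using sum by simp
qed

lemma evader_path_at_step:
  assumes "evader_path X d D E e" "D > 0"
  shows "e (real i * D) = E i"
proof -
  obtain g where g: "geodesic X d (E i) (E (Suc i)) g"
    "\<forall>t\<in>{real i * D..real (Suc i) * D}. e t = g (d (E i) (E (Suc i)) / D * (t - real i * D))"
    using assms by (auto simp: evader_path_def)
  have "e (real i * D) = g 0"
    using g(2) assms(2) by simp
  then show ?thesis using g(1) by (simp add: geodesic_def)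
qed

lemma evader_path_bounded:
  assumes path: "evader_path X d D E e" and D: "D > 0"
    and E: "\<And>i. E i \<in> X" "\<And>i. d (E i) (E (Suc i)) \<le> D" and t: "0 \<le> t"
  shows "e t \<in> X" "d (E 0) (e t) \<le> t + D"
proof -
  define i where "i = nat \<lfloor>t / D\<rfloor>"
  have "real i \<le> t / D" "t / D \<le> real (Suc i)"
    unfolding i_def using t D by simp linarith
  then have i: "real i * D \<le> t" "t \<le> real (Suc i) * D"
    using D by (simp_all add: field_simps)
  define s where "s = d (E i) (E (Suc i))"
  define u where "u = s / D * (t - real i * D)"
  obtain g where g: "geodesic X d (E i) (E (Suc i)) g" "e t = g u"
    using path i by (fastforce simp: evader_path_def u_def s_def)
  have "u \<le> s / D * D"
    unfolding u_def using i D by (intro mult_left_mono) (auto simp: s_def algebra_simps)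
  then have u: "0 \<le> u" "u \<le> s"
    using i D by (simp_all add: u_def s_def)
  show X: "e t \<in> X"
    using g geodesic_point(1) u by (simp add: s_def)
  have "d (E 0) (E j) \<le> real j * D" for j
  proof (induction j)
    case (Suc j)
    then show ?case
      using triangle[of "E 0" "E j" "E (Suc j)"] E(1) E(2)[of j] by (force simp: algebra_simps)
  qed (use E in simp)
  from this[of i] show "d (E 0) (e t) \<le> t + D"
    using triangle[OF E(1) E(1)[of i] X, of 0] geodesic_point(2)[OF g(1), of u] u i g(2) E(2)[of i]
    by (simp add: s_def)
qed

text \<open>
  Boundedness is what makes the least radius exist: otherwise \<open>LEAST\<close> would denote an unspecified
  number.
\<close>

lemma dist_le_circumradius:
  assumes X: "\<And>s. 0 \<le> s \<Longrightarrow> s \<le> t \<Longrightarrow> e s \<in> X"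
    and bdd: "\<And>s. 0 \<le> s \<Longrightarrow> s \<le> t \<Longrightarrow> d (e 0) (e s) \<le> b"
    and s: "0 \<le> s" "s \<le> t"
  shows "d (e 0) (e s) \<le> circumradius X d e t"
proof -
  let ?S = "(\<lambda>s. d (e 0) (e s)) ` {0..t}"
  have bdd': "bdd_above ?S" using bdd by (auto intro!: bdd_aboveI)
  have ne: "?S \<noteq> {}" using s by auto
  have ball: "e ` {0..t} \<subseteq> mcball (e 0) r \<longleftrightarrow> (\<forall>x\<in>?S. x \<le> r)" for r
    using X s by (fastforce simp: image_subset_iff)
  have "circumradius X d e t = Sup ?S"
    unfolding circumradius_def ball
  proof (rule Least_equality)
    show "\<forall>x\<in>?S. x \<le> Sup ?S"
      using bdd' by (blast intro: cSup_upper)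
    show "Sup ?S \<le> r" if "\<forall>x\<in>?S. x \<le> r" for r
      using that ne by (blast intro: cSup_least)
  qed
  then show ?thesis
    using bdd' s by (auto intro!: cSup_upper)
qed

end

section \<open>The circumradius of the evader's path\<close>

text \<open>Solved for \<open>f\<close>, the hypothesis bounds \<open>f\<close> below by a function asymptotic to \<open>sqrt t / K\<close>.\<close>

lemma bigomega_sqrt_if_linear_le:
  fixes f :: "real \<Rightarrow> real"
  assumes "0 < K" and ev: "eventually (\<lambda>t. t \<le> f t * (1 + K * sqrt t) + C * sqrt t + B) at_top"
  shows "f \<in> \<Omega>[at_top](\<lambda>t. t powr (1/2))"
proof -
  define h where "h t = (t - C * sqrt t - B) / (1 + K * sqrt t)" for t
  have "(\<lambda>t. t powr (1/2)) \<in> O[at_top](h)"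
    unfolding h_def using assms(1) by real_asymp
  moreover have "h \<in> O[at_top](f)"
  proof (rule landau_o.big_mono)
    have "eventually (\<lambda>t. 0 \<le> h t) at_top"
      unfolding h_def using assms(1) by real_asymp
    with ev eventually_gt_at_top[of 0]
    show "eventually (\<lambda>t. norm (h t) \<le> norm (f t)) at_top"
    proof eventually_elim
      case (elim t)
      have "0 < 1 + K * sqrt t"
        using assms(1) elim by (simp add: add_pos_nonneg)
      then have "h t \<le> f t"
        using elim unfolding h_def by (subst pos_divide_le_eq) auto
      then show ?case using elim by simp
    qed
  qed
  ultimately show ?thesis
    using landau_o.big_trans by (auto simp: bigomega_iff_bigo)
qed

theorem corollary11:
  fixes X :: "'a set" and d :: "'a \<Rightarrow> 'a \<Rightarrow> real" and D :: real
    and E P :: "nat \<Rightarrow> 'a" and e :: "real \<Rightarrow> 'a"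
  assumes "CAT0_space X d"
    and "D > 0"
    and "simple_pursuit X d D E P"
    and "evader_path X d D E e"
    and "evader_wins d D E P"
  shows "circumradius X d e \<in> \<Omega>[at_top](\<lambda>t. t powr (1/2))"
proof -
  interpret CAT0 X d using assms(1) by unfold_locales
  note D = \<open>D > 0\<close>
  note game = assms(3,5) D
  note pos = evader_wins_positions[OF game]
  note path = evader_path_bounded[OF assms(4) D pos(1) pos(3)]
  have e: "e (real i * D) = E i" for i
    by (rule evader_path_at_step[OF assms(4) D])
  have e0: "e 0 = E 0" using e[of 0] by simp
  obtain l where l: "D < l" and lim: "(\<lambda>i. d (P i) (E i)) \<longlonglongrightarrow> l"
    using assms(5) by (auto simp: evader_wins_def)
  have dec: "decseq (\<lambda>i. d (P i) (E i))" by (rule pursuit_distance_antimono[OF game])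
  have L: "l \<le> d (P i) (E i)" for i
    by (rule decseq_ge[OF dec lim])
  \<comment> \<open>The rounds before \<open>N\<close>, in which the loss can be large, only contribute the constants \<open>a\<close> and
    \<open>D * real N\<close> to the final estimate.\<close>
  have "eventually (\<lambda>i. d (P i) (E i) < l + D) sequentially"
    using order_tendstoD(2)[OF lim] D by simp
  then obtain N where N: "d (P N) (E N) < l + D"
    by (auto simp: eventually_sequentially)

  define a where "a = radial (E 0) (P N) (E N)"
  define K where "K = sqrt 2 * D / (l - D)"
  have K: "0 < K" using D l by (simp add: K_def)
  define r where "r = circumradius X d e"
  have le_r: "d (E 0) (e s) \<le> r t" if "0 \<le> s" "s \<le> t" for s t
    unfolding r_def e0[symmetric]
  proof (rule dist_le_circumradius)
    show "e u \<in> X" if "0 \<le> u" for u using path(1) that .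
    show "d (e 0) (e u) \<le> t + D" if "0 \<le> u" "u \<le> t" for u
      using path(2)[of u] that by (simp add: e0)
  qed (use that in auto)

  \<comment> \<open>All rounds before time \<open>t\<close> take place within distance \<open>r t\<close> of \<open>E 0\<close>.\<close>
  have "t \<le> r t * (1 + K / sqrt D * sqrt t) + D * K / sqrt D * sqrt t + (D * (real N + 2) + l - a)"
    if t: "t \<ge> real N * D" for t
  proof -
    have t0: "0 \<le> t" using t D by (meson mult_nonneg_nonneg of_nat_0_le_iff less_imp_le order_trans)
    have r0: "0 \<le> r t"
      using le_r[of 0 t] t0 nonneg[of "E 0" "e 0"] by linarith
    define n where "n = nat \<lfloor>t / D\<rfloor>"
    have n: "real n \<le> t / D" "t / D \<le> real n + 1"
      using t0 D by (simp_all add: n_def)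
    have "N \<le> n"
      using t D by (simp add: n_def le_nat_floor field_simps)
    then obtain m where m: "n = N + m" using le_Suc_ex by blast
    have E_le: "d (E 0) (E i) \<le> r t" if "i \<le> n" for i
    proof -
      have "real i \<le> t / D" using that n by linarith
      then have "real i * D \<le> t" using D by (simp add: field_simps)
      then show ?thesis using le_r[of "real i * D" t] D by (simp add: e)
    qed
    have "a + D * real m - (r t + D) * K * sqrt (real m) \<le> radial (E 0) (P n) (E n)"
      unfolding a_def K_def m using l L N r0 E_le m pos(1)
      by (intro radial_pursuit[OF game]) auto
    also have "\<dots> \<le> d (E 0) (P n)"
      using pos by (intro radial_le_dist) auto
    also have "\<dots> \<le> d (E 0) (E n) + d (P n) (E n)"
      using triangle[of "E 0" "E n" "P n"] pos by (simp add: commute)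
    also have "\<dots> \<le> r t + (l + D)"
      using E_le[of n] decseqD[OF dec \<open>N \<le> n\<close>] N by simp
    finally have 1: "a + D * real m - (r t + D) * K * sqrt (real m) \<le> r t + (l + D)" .
    have "sqrt (real m) \<le> sqrt (t / D)"
      using n m by simp
    then have "(r t + D) * K * sqrt (real m) \<le> (r t + D) * K * sqrt (t / D)"
      using r0 D K by (intro mult_left_mono) auto
    moreover have "t \<le> D * (real N + real m + 1)"
      using n D m by (simp add: field_simps)
    ultimately show ?thesis
      using 1 by (simp add: real_sqrt_divide algebra_simps)
  qed
  then have ev: "eventually (\<lambda>t. t \<le> r t * (1 + K / sqrt D * sqrt t) + D * K / sqrt D * sqrt t
      + (D * (real N + 2) + l - a)) at_top"
    by (rule eventually_at_top_linorderI)
  show ?thesis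
    using bigomega_sqrt_if_linear_le[OF _ ev] K D by (simp add: r_def)
qed

end
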